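(* Let $p$ be an odd prime and $n\ge 1$ an integer. Let $f:\mathbb{F}_{p^n}^*\to\mathbb{F}_p$ be a difference balanced function which is balanced. Then $f$ is $d$-homogeneous for some integer $d$; that is, there exists an integer $d$ with $\gcd(d,p-1)=1$ such that $f(ax)=a^d f(x)$ for all $a\in\mathbb{F}_p^*$ and all $x\in\mathbb{F}_{p^n}^*$.
   Context: A function $h:\mathbb{F}_{p^n}^*\to\mathbb{F}_p$ is balanced if $|\{x\in\mathbb{F}_{p^n}^*: h(x)=0\}|=p^{n-1}-1$ and $|\{x\in\mathbb{F}_{p^n}^*: h(x)=b\}|=p^{n-1}$ for each $b\in\mathbb{F}_p^*$. A function $f:\mathbb{F}_{p^n}^*\to\mathbb{F}_p$ is difference balanced if for each $a\in\mathbb{F}_{p^n}^*\setminus\{1\}$ the function $x\mapsto f(ax)-f(x)$ is balanced. *)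

theory Defs
  imports "HOL-Library.Cardinality" "HOL-Number_Theory.Number_Theory"
begin

text \<open>
  The field with \<open>p ^ n\<close> elements is a type \<^typ>\<open>'a\<close> of class \<open>{finite, field}\<close> with
  \<open>CARD('a) = p ^ n\<close>. The field with \<open>p\<close> elements is its prime subfield, the image of the
  integers in \<^typ>\<open>'a\<close>; so maps into it are maps into \<^typ>\<open>'a\<close> with values there.
  Maps on the nonzero elements are total functions whose value at \<open>0\<close> is never referred to.
\<close>

abbreviation prime_field :: "'a::ring_1 set"
  where "prime_field \<equiv> \<int>"

lemma card_prime_field:
  assumes "prime (p::nat)" "CARD('a::{finite,field}) = p ^ n"
  shows "card (prime_field :: 'a set) = p"
proof -
  have pos: "CHAR('a) > 0"
    by (rule finite_imp_CHAR_pos) simp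
  then have "prime CHAR('a)"
    by (rule prime_CHAR_semidom)
  moreover have "CHAR('a) dvd p ^ n"
    using CHAR_dvd_CARD[where 'a = 'a] assms(2) by simp
  ultimately have char: "CHAR('a) = p"
    using assms(1) by (metis prime_dvd_power primes_dvd_imp_eq)
  have eq: "(of_int i :: 'a) = of_int j \<longleftrightarrow> i mod int p = j mod int p" for i j
    using of_int_eq_0_iff_char_dvd[where 'a = 'a, of "i - j"] char
    by (simp add: mod_eq_dvd_iff)
  have "(prime_field :: 'a set) = of_int ` {0..<int p}"
  proof
    show "(prime_field :: 'a set) \<subseteq> of_int ` {0..<int p}"
    proof
      fix x :: 'a assume "x \<in> prime_field"
      then obtain i where "x = of_int i" by (auto simp: Ints_def)
      then have "x = of_int (i mod int p)" using eq by simp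
      moreover have "i mod int p \<in> {0..<int p}" using assms(1) prime_gt_0_nat by simp
      ultimately show "x \<in> of_int ` {0..<int p}" by blast
    qed
  qed auto
  moreover have "inj_on (of_int :: int \<Rightarrow> 'a) {0..<int p}"
    by (auto simp: inj_on_def eq)
  ultimately show ?thesis
    by (metis card_image card_atLeastLessThan_int diff_zero nat_int)
qed

definition balanced :: "nat \<Rightarrow> nat \<Rightarrow> ('a::{finite,field} \<Rightarrow> 'a) \<Rightarrow> bool"
  where "balanced p n h \<longleftrightarrow>
    card {x. x \<noteq> 0 \<and> h x = 0} = p ^ (n - 1) - 1 \<and>
    (\<forall>b\<in>prime_field - {0}. card {x. x \<noteq> 0 \<and> h x = b} = p ^ (n - 1))"

definition difference_balanced :: "nat \<Rightarrow> nat \<Rightarrow> ('a::{finite,field} \<Rightarrow> 'a) \<Rightarrow> bool"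
  where "difference_balanced p n f \<longleftrightarrow>
    (\<forall>a. a \<noteq> 0 \<and> a \<noteq> 1 \<longrightarrow> balanced p n (\<lambda>x. f (a * x) - f x))"

definition homogeneous :: "nat \<Rightarrow> int \<Rightarrow> ('a::{finite,field} \<Rightarrow> 'a) \<Rightarrow> bool"
  where "homogeneous p d f \<longleftrightarrow>
    gcd d (int p - 1) = 1 \<and>
    (\<forall>a\<in>prime_field - {0}. \<forall>x. x \<noteq> 0 \<longrightarrow> f (a * x) = a powi d * f x)"

end

theory Submission
  imports Defs "HOL-Library.Poly_Mapping" "HOL-Computational_Algebra.Polynomial"
begin

text \<open>
  In the group ring of the product of the multiplicative group of the field and the additive
  group of its prime field, the graph of \<open>f\<close> is an element \<open>\<theta>\<close> with
  \<open>\<theta> \<theta>* = p ^ n - \<Gamma>\<close> up to terms killed by \<open>l = 1 - z\<close>, where \<open>\<Gamma>\<close> is the sum of the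
  multiplicative group and \<open>z\<close> generates the prime field. Passing to \<open>\<theta> - \<Gamma>\<close> makes the
  right-hand side divisible by \<open>p ^ n\<close>. The endomorphism \<open>\<sigma>\<close> induced by multiplying the second
  coordinate by \<open>t\<close> plays the part of inertia at \<open>p\<close>: it is the identity modulo \<open>l\<close>, so it
  preserves valuations, and \<open>(\<sigma> \<theta> - \<Gamma>) (\<theta>* - \<Gamma>)\<close> is divisible by \<open>p ^ n\<close> as well. On coefficients,
  the number of \<open>x\<close> with \<open>t f(ax) - f(x) = b\<close> (plus one if \<open>b = 0\<close>) is independent of \<open>b\<close> modulo
  \<open>p ^ n\<close>. These numbers lie between \<open>0\<close> and \<open>p ^ n\<close>, so either they are all equal or
  \<open>t f(ax) = f(x)\<close> for all \<open>x\<close>. Counting pairs with \<open>t f(y) = f(x)\<close> excludes that the first case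
  occurs for every \<open>a\<close>. Taking for \<open>t\<close> a generator of the nonzero elements of the prime field,
  the resulting \<open>a\<close> is again such a generator, and \<open>d\<close> is read off from \<open>inverse t = a ^ d\<close>.
\<close>

subsection \<open>Ramified endomorphisms\<close>

text \<open>Modulo \<open>l ^ m\<close> the factor \<open>1 + l * v\<close> is a unit, inverted by
  the truncated geometric series in \<open>- (l * v)\<close>.\<close>

lemma power_dvd_cancel_one_plus:
  fixes l v x :: "'r::comm_ring_1"
  assumes "l ^ m dvd x * (1 + l * v)"
  shows "l ^ m dvd x"
proof -
  have "1 - (- (l * v)) ^ m = (1 + l * v) * (\<Sum>i<m. (- (l * v)) ^ i)"
    using one_diff_power_eq[of "- (l * v)" m] by simp
  then have "x - x * (- (l * v)) ^ m = x * (1 + l * v) * (\<Sum>i<m. (- (l * v)) ^ i)"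
    by (metis mult.assoc mult.right_neutral right_diff_distrib)
  then have "l ^ m dvd x - x * (- (l * v)) ^ m"
    using assms by simp
  moreover have "l ^ m dvd x * (- (l * v)) ^ m"
    by (simp add: power_minus[of "l * v"] power_mult_distrib)
  ultimately show ?thesis
    by (metis diff_add_cancel dvd_add)
qed

text \<open>
  This replaces the decomposition of the group ring into unramified discrete valuation rings:
  \<open>a ^ N\<close> is idempotent modulo \<open>l\<close>, and splitting \<open>1\<close> into \<open>a ^ N\<close> and its complement moves a
  factor \<open>l\<close> out of \<open>b\<close> or out of \<open>a\<close>. Everything is multiplied by \<open>l\<close> because only the quotient
  by the annihilator of \<open>l\<close>, in which \<open>l\<close> is a nonzerodivisor, matters.
\<close>

lemma ramified_endomorphism_dvd:
  fixes l :: "'r::comm_ring_1" and \<sigma> :: "'r \<Rightarrow> 'r"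
  assumes add: "\<And>x y. \<sigma> (x + y) = \<sigma> x + \<sigma> y"
    and mult: "\<And>x y. \<sigma> (x * y) = \<sigma> x * \<sigma> y"
    and one: "\<sigma> 1 = 1"
    and inert: "\<And>x. l dvd \<sigma> x - x"
    and assoc: "\<sigma> l dvd l"
    and cancel: "\<And>x. l * l * x = 0 \<Longrightarrow> l * x = 0"
    and frob: "\<And>x. l * l dvd l * (x ^ Suc N - x)"
    and "N > 0"
    and "l ^ Suc m dvd l * (a * b)"
  shows "l ^ Suc m dvd l * (\<sigma> a * b)"
  using assms(9)
proof (induction m arbitrary: a b)
  case 0
  then show ?case by simp
next
  case (Suc m)
  have diff: "\<sigma> (x - y) = \<sigma> x - \<sigma> y" for x y
    using add[of "x - y" y] by simp
  have cancel_dvd: "l ^ Suc m dvd l * y" if y: "l ^ Suc (Suc m) dvd l * l * y" for y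
  proof -
    obtain w where "l * l * y = l ^ Suc (Suc m) * w"
      using y by (elim dvdE)
    then have "l * l * (y - l ^ m * w) = 0"
      by (simp add: algebra_simps)
    then have "l * (y - l ^ m * w) = 0"
      by (rule cancel)
    then have "l * y = l ^ Suc m * w"
      by (simp add: algebra_simps)
    then show ?thesis by simp
  qed
  obtain w where w: "l * (a * b) = l ^ Suc (Suc m) * w"
    using Suc.prems by auto
  define e where "e = a ^ N"
  obtain N' where N': "N = Suc N'"
    using \<open>N > 0\<close> by (cases N) auto
  \<comment> \<open>\<open>b1\<close> is \<open>b * e\<close> with one factor \<open>l\<close> taken
    out, up to the annihilator of \<open>l\<close>; one of the \<open>N\<close> factors
    \<open>a\<close> in \<open>e\<close> is spent on the divisibility of
    \<open>a * b\<close>.\<close>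
  define b1 where "b1 = l ^ m * w * a ^ N'"
  have be: "l * (b * e) = l * l * b1"
  proof -
    have "l * (b * e) = l * (a * b) * a ^ N'"
      by (simp add: e_def N' algebra_simps)
    also have "\<dots> = l * l * b1"
      unfolding w by (simp add: b1_def mult_ac)
    finally show ?thesis .
  qed
  have "l ^ Suc (Suc m) dvd l * l * (a * b1)"
  proof -
    have "l * l * (a * b1) = l * (a * b) * e"
      using arg_cong[OF be, of "\<lambda>x. x * a"] by (simp add: mult_ac)
    then show ?thesis
      using Suc.prems by simp
  qed
  then have "l ^ Suc m dvd l * (\<sigma> a * b1)"
    by (intro Suc.IH cancel_dvd)
  then have "l * l ^ Suc m dvd l * (l * (\<sigma> a * b1))"
    by (rule mult_dvd_mono[OF dvd_refl])
  also have "l * (l * (\<sigma> a * b1)) = l * (\<sigma> a * b * e)"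
    using arg_cong[OF be, of "\<lambda>x. \<sigma> a * x"] by (simp add: mult_ac)
  finally have 1: "l ^ Suc (Suc m) dvd l * (\<sigma> a * b * e)"
    by simp
  obtain a1 where a1: "l * (a - a * e) = l * l * a1"
  proof -
    have "l * l dvd - (l * (a ^ Suc N - a))"
      using frob[of a] by (simp only: dvd_minus_iff)
    also have "- (l * (a ^ Suc N - a)) = l * (a - a * e)"
      by (simp add: e_def algebra_simps)
    finally show ?thesis using that by (auto elim: dvdE)
  qed
  have "l ^ Suc (Suc m) dvd l * l * (a1 * b)"
  proof -
    have "l * l * (a1 * b) = l * (a - a * e) * b"
      by (simp only: a1 mult.assoc)
    also have "\<dots> = l * (a * b) * (1 - e)"
      by (simp add: algebra_simps)
    finally show ?thesis
      using Suc.prems by simp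
  qed
  then have IH2: "l ^ Suc m dvd l * (\<sigma> a1 * b)"
    by (intro Suc.IH cancel_dvd)
  obtain \<mu> where \<mu>: "\<sigma> l = l * \<mu>"
  proof -
    have "l dvd \<sigma> l"
      using inert[of l] by (metis diff_add_cancel dvd_add dvd_refl)
    then show ?thesis using that by auto
  qed
  obtain \<nu> where \<nu>: "l = \<sigma> l * \<nu>"
    using assoc by auto
  \<comment> \<open>Applying \<open>\<sigma>\<close> to the equation for \<open>a1\<close> yields
    two factors \<open>\<sigma> l\<close>; \<open>\<nu>\<close> and \<open>\<mu>\<close> turn them
    back into factors \<open>l\<close>.\<close>
  have "l * (\<sigma> a - \<sigma> a * \<sigma> e) = \<nu> * \<sigma> (l * (a - a * e))"
    by (subst \<nu>) (simp add: mult diff algebra_simps)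
  also have "\<dots> = l * \<sigma> l * \<sigma> a1"
    unfolding a1 by (subst (3) \<nu>) (simp add: mult algebra_simps)
  also have "\<dots> = l * l * (\<mu> * \<sigma> a1)"
    by (simp add: \<mu> mult_ac)
  finally have "l * ((\<sigma> a - \<sigma> a * \<sigma> e) * b) = l * (l * (\<sigma> a1 * b)) * \<mu>"
    by (metis mult.assoc mult.commute)
  moreover have "l * l ^ Suc m dvd l * (l * (\<sigma> a1 * b))"
    using IH2 by (rule mult_dvd_mono[OF dvd_refl])
  ultimately have 2: "l ^ Suc (Suc m) dvd l * ((\<sigma> a - \<sigma> a * \<sigma> e) * b)"
    by simp
  obtain v where v: "\<sigma> e - e = l * v"
    using inert[of e] by auto
  \<comment> \<open>One part is cut out by \<open>e\<close>, the other by
    \<open>1 - \<sigma> e\<close>, so they add up to \<open>\<sigma> a * b\<close> only up to a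
    factor congruent to \<open>1\<close> modulo \<open>l\<close>.\<close>
  have "l * (\<sigma> a * b) * (1 + l * (- v)) = l * (\<sigma> a * b * e) + l * ((\<sigma> a - \<sigma> a * \<sigma> e) * b)"
    by (simp add: algebra_simps flip: v)
  then have "l ^ Suc (Suc m) dvd l * (\<sigma> a * b) * (1 + l * (- v))"
    using 1 2 by simp
  then show ?case
    by (rule power_dvd_cancel_one_plus)
qed

section \<open>Ramification of \<open>p\<close> at \<open>1 - z\<close>\<close>

locale prime_order_unit =
  fixes z :: "'r::comm_ring_1" and p :: nat
  assumes prime: "prime p" and odd: "odd p"
    and order: "z ^ p = 1"
    and torsion_free: "of_nat p * (x::'r) = 0 \<Longrightarrow> x = 0"
begin

definition l :: 'r where "l = 1 - z"

text \<open>The \<open>p\<close>-th cyclotomic polynomial at \<open>z\<close>. Multiplication by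
  \<open>l\<close> kills it, so \<open>z\<close> then behaves like a primitive \<open>p\<close>-th
  root of unity.\<close>

definition \<Phi> :: 'r where "\<Phi> = (\<Sum>k<p. z ^ k)"

lemma l_mult_\<Phi>: "l * \<Phi> = 0"
  using one_diff_power_eq[of z p] by (simp add: l_def \<Phi>_def order)

lemma l_dvd_one_minus_power: "l dvd 1 - z ^ k"
  using one_diff_power_eq[of z k] by (simp add: l_def)

text \<open>All powers of \<open>z\<close> are \<open>1\<close> modulo \<open>l\<close>, so
  \<open>\<Phi>\<close> is congruent to \<open>p\<close>; multiplying by \<open>l\<close> removes
  \<open>\<Phi>\<close>.\<close>

lemma l_mult_prime_eq:
  obtains w where "l * of_nat p = l * l * w"
proof -
  have "l dvd (\<Sum>k<p. 1 - z ^ k)"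
    by (intro dvd_sum l_dvd_one_minus_power)
  also have "(\<Sum>k<p. 1 - z ^ k) = of_nat p - \<Phi>"
    by (simp add: \<Phi>_def sum_subtractf)
  finally obtain w where "of_nat p = \<Phi> + l * w"
    by (auto elim!: dvdE simp: algebra_simps)
  then have "l * of_nat p = l * l * w"
    by (simp add: l_mult_\<Phi> algebra_simps)
  then show thesis by (rule that)
qed

lemma l_cancel:
  assumes "l * l * x = 0"
  shows "l * x = 0"
proof -
  obtain w where w: "l * of_nat p = l * l * w"
    by (rule l_mult_prime_eq)
  have "of_nat p * (l * x) = l * of_nat p * x"
    by (simp add: mult_ac)
  also have "\<dots> = l * l * x * w"
    unfolding w by (simp only: mult_ac)
  finally show ?thesis
    using assms torsion_free by simp
qed

text \<open>
  The quotient of \<open>l ^ p\<close> by \<open>l * p\<close> is congruent to \<open>-1\<close> modulo \<open>l\<close>.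
\<close>

lemma l_power_prime:
  "l ^ p dvd l * of_nat p" "l * of_nat p dvd l ^ p"
proof -
  define q where "q = p - 1"
  have p: "p = Suc q"
    using prime prime_gt_0_nat[of p] by (simp add: q_def)
  have "even q"
    using odd by (simp add: p)
  define c where "c k = ((-1) ^ k * int (q choose k) - 1) div int p" for k
  have c: "int p * c k = (-1) ^ k * int (q choose k) - 1" if "k < p" for k
  proof -
    have "int p dvd (-1) ^ k * int (q choose k) - 1"
      using that
    proof (induction k)
      case 0
      then show ?case by simp
    next
      case (Suc k)
      have "p dvd p choose Suc k"
        using Suc.prems prime by (intro dvd_choose_prime) auto
      then have "int p dvd int (q choose k) + int (q choose Suc k)"
        by (metis p binomial_Suc_Suc int_dvd_int_iff of_nat_add)
      then have "int p dvd (-1) ^ k * (int (q choose k) + int (q choose Suc k))"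
        by simp
      moreover have "int p dvd (-1) ^ k * int (q choose k) - 1"
        using Suc by simp
      ultimately have "int p dvd ((-1) ^ k * int (q choose k) - 1)
          - (-1) ^ k * (int (q choose k) + int (q choose Suc k))"
        using dvd_diff by blast
      also have "\<dots> = (-1) ^ Suc k * int (q choose Suc k) - 1"
        by (simp add: algebra_simps)
      finally show ?case .
    qed
    then show ?thesis by (simp add: c_def)
  qed
  \<comment> \<open>\<open>l ^ q\<close> equals \<open>of_nat p * u + \<Phi>\<close>, because its
    binomial coefficients with sign are \<open>1\<close> modulo \<open>p\<close>.\<close>
  define u where "u = (\<Sum>k<p. of_int (c k) * z ^ k)"
  have "l ^ q = (\<Sum>k\<le>q. of_nat (q choose k) * (- z) ^ k)"
    using binomial_ring[of "- z" 1 q] by (simp add: l_def)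
  also have "\<dots> = (\<Sum>k<p. of_int ((-1) ^ k * int (q choose k)) * z ^ k)"
    unfolding p lessThan_Suc_atMost
    by (intro sum.cong refl) (simp add: power_minus[of z] mult_ac)
  also have "\<dots> = (\<Sum>k<p. of_int (int p * c k + 1) * z ^ k)"
    by (intro sum.cong refl) (simp add: c)
  also have "\<dots> = of_nat p * u + \<Phi>"
    by (simp add: u_def \<Phi>_def sum_distrib_left sum.distrib algebra_simps)
  finally have "l * l ^ q = l * of_nat p * u"
    by (simp add: l_mult_\<Phi> algebra_simps)
  then have lp: "l ^ p = l * of_nat p * u"
    by (simp add: p)
  then show "l * of_nat p dvd l ^ p" by simp
  \<comment> \<open>Setting \<open>z\<close> to \<open>1\<close> gives the residue of
    \<open>u\<close> modulo \<open>l\<close>; the alternating binomial sum vanishes, which leaves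
    \<open>- 1\<close>.\<close>
  have "int p * (\<Sum>k<p. c k) = (\<Sum>k<p. (-1) ^ k * int (q choose k)) - int p"
    by (simp add: sum_distrib_left c sum_subtractf)
  also have "(\<Sum>k<p. (-1) ^ k * int (q choose k)) = 0"
    unfolding p lessThan_Suc_atMost using prime prime_gt_1_nat[of p]
    by (intro choose_alternating_sum) (simp add: p)
  finally have "int p * (\<Sum>k<p. c k) = int p * (- 1)" by simp
  then have sum_c: "(\<Sum>k<p. c k) = - 1"
    using prime_gt_0_nat[OF prime] by (simp only: mult_cancel_left) simp
  have "l dvd (\<Sum>k<p. of_int (c k) * (1 - z ^ k))"
    by (intro dvd_sum dvd_mult l_dvd_one_minus_power)
  also have "(\<Sum>k<p. of_int (c k) * (1 - z ^ k)) = of_int (\<Sum>k<p. c k) - u"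
    by (simp add: u_def sum_subtractf right_diff_distrib)
  finally obtain v where "- 1 - u = l * v"
    unfolding sum_c by auto
  then have "u = - (1 + l * v)"
    by (simp add: algebra_simps)
  with lp have "- (l ^ p) = l * of_nat p * (1 + l * v)"
    by (simp only: mult_minus_right minus_minus)
  then have "l ^ p dvd l * of_nat p * (1 + l * v)"
    by (metis dvd_minus_iff dvd_refl)
  then show "l ^ p dvd l * of_nat p"
    by (rule power_dvd_cancel_one_plus)
qed

text \<open>Translates between divisibility by \<open>p ^ n\<close> and by powers of
  \<open>l\<close>, where \<open>p\<close> counts as \<open>l ^ (p - 1)\<close>.\<close>

lemma l_power_prime_power:
  "l ^ Suc (n * (p - 1)) dvd l * of_nat p ^ n" "l * of_nat p ^ n dvd l ^ Suc (n * (p - 1))"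
proof (induction n)
  case (Suc n)
  have p: "l * l ^ (p - 1) = l ^ p"
    using prime prime_gt_0_nat[of p] by (cases p) auto
  have eq: "l ^ Suc (Suc n * (p - 1)) = l ^ p * l ^ (n * (p - 1))"
    unfolding p[symmetric] by (simp add: power_add)
  {
    case 1
    have "l ^ p * l ^ (n * (p - 1)) dvd l * of_nat p * l ^ (n * (p - 1))"
      by (intro mult_dvd_mono l_power_prime dvd_refl)
    also have "\<dots> = l ^ Suc (n * (p - 1)) * of_nat p"
      by (simp add: mult_ac)
    also have "\<dots> dvd l * of_nat p ^ n * of_nat p"
      by (intro mult_dvd_mono Suc dvd_refl)
    finally show ?case by (simp only: eq power_Suc[of "of_nat p"] mult_ac)
  next
    case 2
    have "l * of_nat p ^ n * of_nat p dvd l ^ Suc (n * (p - 1)) * of_nat p"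
      by (intro mult_dvd_mono Suc dvd_refl)
    also have "\<dots> = l * of_nat p * l ^ (n * (p - 1))"
      by (simp add: mult_ac)
    also have "\<dots> dvd l ^ p * l ^ (n * (p - 1))"
      by (intro mult_dvd_mono l_power_prime dvd_refl)
    finally show ?case by (simp only: eq power_Suc[of "of_nat p"] mult_ac)
  }
qed simp_all

end

subsection \<open>The group ring\<close>

abbreviation coef :: "('k \<Rightarrow>\<^sub>0 'c::zero) \<Rightarrow> 'k \<Rightarrow> 'c"
  where "coef \<equiv> poly_mapping.lookup"

lemma poly_mapping_additive_induct [case_names single add]:
  fixes u :: "'k \<Rightarrow>\<^sub>0 'c::comm_monoid_add"
  assumes single: "\<And>k c. P (Poly_Mapping.single k c)"
    and add: "\<And>u v. P u \<Longrightarrow> P v \<Longrightarrow> P (u + v)"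
  shows "P u"
proof -
  have "P (\<Sum>k\<in>A. Poly_Mapping.single k (coef u k))" if "finite A" for A
    using that
  proof induction
    case empty
    then show ?case using single[of _ 0] by simp
  qed (simp add: single add)
  moreover have "u = (\<Sum>k\<in>Poly_Mapping.keys u. Poly_Mapping.single k (coef u k))"
    by (rule poly_mapping_eqI) (auto simp: lookup_sum lookup_single when_def in_keys_iff)
  ultimately show ?thesis
    by (metis finite_keys)
qed

lemma lookup_translate:
  fixes u :: "'k::comm_monoid_add \<Rightarrow>\<^sub>0 int"
  assumes "\<And>i j. k + i = k + j \<Longrightarrow> i = j"
  shows "coef (Poly_Mapping.single k 1 * u) (k + m) = coef u m"
proof (induction u rule: poly_mapping_additive_induct)
  case (single j c)
  then show ?case
    using assms by (auto simp: mult_single lookup_single when_def)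
qed (simp add: lookup_add algebra_simps)

lemma lookup_of_nat_mult:
  fixes u :: "'k::comm_monoid_add \<Rightarrow>\<^sub>0 int"
  shows "coef (of_nat m * u) k = int m * coef u k"
  by (induction m) (simp_all add: lookup_add algebra_simps)

text \<open>The linear extension of \<open>\<phi>\<close> to the group ring. Summing over the whole
  finite type instead of the support makes additivity immediate.\<close>

definition push :: "('k \<Rightarrow> 'k) \<Rightarrow> ('k::finite \<Rightarrow>\<^sub>0 'c::comm_monoid_add) \<Rightarrow> ('k \<Rightarrow>\<^sub>0 'c)"
  where "push \<phi> u = (\<Sum>k\<in>UNIV. Poly_Mapping.single (\<phi> k) (coef u k))"

lemma push_add: "push \<phi> (u + v) = push \<phi> u + push \<phi> v"
  by (simp add: push_def lookup_add single_add sum.distrib)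

lemma push_sum: "push \<phi> (sum h A) = (\<Sum>i\<in>A. push \<phi> (h i))"
proof (induction A rule: infinite_finite_induct)
qed (simp_all add: push_add, simp_all add: push_def)

lemma push_single: "push \<phi> (Poly_Mapping.single k c) = Poly_Mapping.single (\<phi> k) c"
proof -
  have "push \<phi> (Poly_Mapping.single k c)
      = (\<Sum>j\<in>UNIV. if j = k then Poly_Mapping.single (\<phi> k) c else 0)"
    unfolding push_def by (rule sum.cong) (auto simp: lookup_single when_def)
  then show ?thesis by simp
qed

lemma push_mult:
  fixes u v :: "'k::{finite,comm_monoid_add} \<Rightarrow>\<^sub>0 'c::comm_semiring_0"
  assumes "\<And>i j. \<phi> (i + j) = \<phi> i + \<phi> j"
  shows "push \<phi> (u * v) = push \<phi> u * push \<phi> v"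
proof (induction u rule: poly_mapping_additive_induct)
  case (single k c)
  show ?case
    by (induction v rule: poly_mapping_additive_induct)
      (simp_all add: push_single mult_single assms push_add algebra_simps)
qed (simp add: push_add algebra_simps)

text \<open>
  The product group is written additively, since the product of type \<open>\<Rightarrow>\<^sub>0\<close> is convolution along \<open>+\<close>.
\<close>

typedef (overloaded) 'a graph_group = "{(x::'a::field, b::'a). x \<noteq> 0 \<and> b \<in> prime_field}"
  by (intro exI[of _ "(1, 0)"]) simp

setup_lifting type_definition_graph_group

instantiation graph_group :: (field) comm_monoid_add
begin

lift_definition zero_graph_group :: "'a graph_group" is "(1, 0)"
  by simp

lift_definition plus_graph_group :: "'a graph_group \<Rightarrow> 'a graph_group \<Rightarrow> 'a graph_group"
  is "\<lambda>(x, b) (y, c). (x * y, b + c)"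
  by auto

instance
  by standard (transfer, auto simp: algebra_simps)+

end

instance graph_group :: ("{finite,field}") finite
proof
  have "finite (range (Rep_graph_group :: 'a graph_group \<Rightarrow> _))"
    by (rule finite)
  then show "finite (UNIV :: 'a graph_group set)"
    by (rule finite_imageD) (simp add: inj_on_def Rep_graph_group_inject)
qed

text \<open>Specified only for \<open>x \<noteq> 0\<close> and \<open>b\<close> in the prime field,
  whence the side conditions below.\<close>

definition pt :: "'a::field \<Rightarrow> 'a \<Rightarrow> 'a graph_group"
  where "pt x b = Abs_graph_group (x, b)"

lemma pt_cases:
  obtains x b where "x \<noteq> 0" "b \<in> prime_field" "k = pt x b"
  by (cases k) (auto simp: pt_def)

lemma pt_eq_iff:
  assumes "x \<noteq> 0" "b \<in> prime_field" "y \<noteq> 0" "c \<in> prime_field"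
  shows "pt x b = pt y c \<longleftrightarrow> x = y \<and> b = c"
  using assms by (simp add: pt_def Abs_graph_group_inject)

lemma pt_add:
  assumes "x \<noteq> 0" "b \<in> prime_field" "y \<noteq> 0" "c \<in> prime_field"
  shows "pt x b + pt y c = pt (x * y) (b + c)"
  using assms
  by (simp add: pt_def plus_graph_group_def Abs_graph_group_inverse)

lemma pt_zero: "pt 1 0 = 0"
  by (simp add: pt_def zero_graph_group_def)

definition scale :: "'a::field \<Rightarrow> 'a graph_group \<Rightarrow> 'a graph_group"
  where "scale t k = (case Rep_graph_group k of (x, b) \<Rightarrow> pt x (t * b))"

lemma scale_pt:
  assumes "x \<noteq> 0" "b \<in> prime_field"
  shows "scale t (pt x b) = pt x (t * b)"
  using assms by (simp add: scale_def pt_def Abs_graph_group_inverse)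

lemma scale_add:
  assumes "t \<in> prime_field"
  shows "scale t (i + j) = scale t i + scale t j"
  by (cases i rule: pt_cases; cases j rule: pt_cases)
    (use assms in \<open>simp add: scale_pt pt_add algebra_simps\<close>)

definition e :: "'a::field \<Rightarrow> 'a \<Rightarrow> ('a graph_group \<Rightarrow>\<^sub>0 int)"
  where "e x b = Poly_Mapping.single (pt x b) 1"

lemma e_mult:
  assumes "x \<noteq> 0" "b \<in> prime_field" "y \<noteq> 0" "c \<in> prime_field"
  shows "e x b * e y c = e (x * y) (b + c)"
  using assms by (simp add: e_def mult_single pt_add)

lemma e_one: "e 1 0 = 1"
  by (simp add: e_def pt_zero)

lemma e_power:
  assumes "x \<noteq> 0" "b \<in> prime_field"
  shows "e x b ^ k = e (x ^ k) (of_nat k * b)"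
proof (induction k)
  case (Suc k)
  then show ?case
    using assms by (simp add: e_mult algebra_simps)
qed (simp add: e_one)

lemma push_scale_e:
  assumes "x \<noteq> 0" "b \<in> prime_field"
  shows "push (scale t) (e x b) = e x (t * b)"
  using assms by (simp add: e_def push_single scale_pt)

lemma push_scale_one: "push (scale t) 1 = (1 :: 'a::{finite,field} graph_group \<Rightarrow>\<^sub>0 int)"
  using push_scale_e[of 1 0 t] by (simp add: e_one)

lemma lookup_e:
  assumes "x \<noteq> 0" "b \<in> prime_field" "y \<noteq> 0" "c \<in> prime_field"
  shows "coef (e x b) (pt y c) = of_bool (x = y \<and> b = c)"
  using assms by (auto simp: e_def lookup_single pt_eq_iff when_def)

section \<open>The finite field and congruences in its group ring\<close>

locale prime_power_field =
  fixes p n :: nat and ty :: "'a::{finite,field} itself"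
  assumes prime: "prime p" and odd: "odd p" and n: "n \<ge> 1"
    and card: "CARD('a) = p ^ n"
begin

lemma char: "CHAR('a) = p"
proof -
  have "prime CHAR('a)"
    by (intro prime_CHAR_semidom finite_imp_CHAR_pos) simp
  moreover have "CHAR('a) dvd p ^ n"
    using CHAR_dvd_CARD[where 'a = 'a] card by simp
  ultimately show ?thesis
    using prime by (metis prime_dvd_power primes_dvd_imp_eq)
qed

lemma of_nat_p: "of_nat p = (0::'a)"
  using of_nat_CHAR[where 'a = 'a] by (simp add: char)

lemma of_nat_eq_iff: "(of_nat i :: 'a) = of_nat j \<longleftrightarrow> [i = j] (mod p)"
  using of_nat_eq_iff_cong_CHAR[where 'a = 'a, of i j] by (simp add: char)

lemma bij_prime_field: "bij_betw of_nat {..<p} (prime_field :: 'a set)"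
proof -
  have inj: "inj_on (of_nat :: nat \<Rightarrow> 'a) {..<p}"
    by (auto simp: inj_on_def of_nat_eq_iff cong_def)
  have "of_nat ` {..<p} = (prime_field :: 'a set)"
  proof (rule card_subset_eq)
    show "card (of_nat ` {..<p} :: 'a set) = card (prime_field :: 'a set)"
      using card_prime_field[OF prime card] card_image[OF inj] by simp
  qed auto
  with inj show ?thesis by (simp add: bij_betw_def)
qed

lemma prime_field_cases:
  assumes "b \<in> (prime_field :: 'a set)"
  obtains k where "k < p" "b = of_nat k"
  using bij_betw_imp_surj_on[OF bij_prime_field] assms by auto

lemma inverse_in_prime_field:
  assumes "t \<in> (prime_field :: 'a set)"
  shows "inverse t \<in> prime_field"
proof (cases "t = 0")
  case False
  obtain k where k: "t = of_nat k"
    using assms(1) by (rule prime_field_cases)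
  then have "\<not> p dvd k"
    using False of_nat_eq_iff[of k 0] by (auto simp: cong_0_iff)
  then obtain j where "[k * j = 1] (mod p)"
    using prime by (metis cong_solve_coprime_nat coprime_commute prime_imp_coprime One_nat_def)
  then have "of_nat j * t = 1"
    unfolding k using of_nat_eq_iff[of "k * j" 1] by (simp add: mult.commute)
  then have "inverse t = of_nat j"
    by (metis inverse_unique mult.commute)
  then show ?thesis by simp
qed simp

lemma card_nonzero: "card {x::'a. x \<noteq> 0} = p ^ n - 1"
proof -
  have "{x::'a. x \<noteq> 0} = UNIV - {0}" by auto
  then show ?thesis by (simp add: card)
qed

text \<open>Multiplication by a nonzero \<open>x\<close> permutes the nonzero elements; compare
  their products.\<close>

lemma power_card: "(x::'a) ^ (p ^ n) = x"
proof (cases "x = 0")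
  case False
  have "(\<Prod>y | y \<noteq> 0. x * y) = (\<Prod>y::'a | y \<noteq> 0. y)"
    by (rule prod.reindex_bij_witness[of _ "\<lambda>y. y / x" "\<lambda>y. x * y"]) (use False in auto)
  then have "x ^ (p ^ n - 1) = 1"
    by (simp add: prod.distrib card_nonzero)
  moreover have "p ^ n = Suc (p ^ n - 1)"
    using prime prime_gt_0_nat by simp
  ultimately show ?thesis
    by (metis power_Suc mult.right_neutral)
qed (use prime prime_gt_0_nat in simp)

sublocale prime_order_unit "e 1 1 :: 'a graph_group \<Rightarrow>\<^sub>0 int" p
proof
  show "e 1 1 ^ p = (1 :: 'a graph_group \<Rightarrow>\<^sub>0 int)"
    by (simp add: e_power of_nat_p e_one)
  show "x = 0" if "of_nat p * x = 0" for x :: "'a graph_group \<Rightarrow>\<^sub>0 int"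
  proof (rule poly_mapping_eqI)
    fix k
    have "int p * coef x k = 0"
      using that by (metis lookup_of_nat_mult lookup_zero)
    then show "coef x k = coef 0 k"
      using prime prime_gt_0_nat by simp
  qed
qed (rule prime odd)+

lemma e_1_of_nat: "e 1 (of_nat k) = (e 1 1 :: 'a graph_group \<Rightarrow>\<^sub>0 int) ^ k"
  by (simp add: e_power)

lemma \<Phi>_eq: "\<Phi> = (\<Sum>b\<in>prime_field. e (1::'a) b)"
proof -
  have "(\<Sum>k<p. e (1::'a) (of_nat k)) = (\<Sum>b\<in>prime_field. e 1 b)"
    by (rule sum.reindex_bij_betw[OF bij_prime_field])
  then show ?thesis by (simp add: \<Phi>_def e_1_of_nat)
qed

text \<open>Second coordinates contribute powers of \<open>e 1 1\<close>, which are \<open>1\<close>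
  modulo \<open>l\<close>: modulo \<open>l\<close> the second coordinate is forgotten.\<close>

lemma l_dvd_e_diff:
  assumes "x \<noteq> (0::'a)" "b \<in> prime_field" "c \<in> prime_field"
  shows "l dvd e x b - e x c"
proof -
  have "l dvd e x 0 - e x b" if b: "b \<in> prime_field" for b
  proof -
    obtain k where "b = of_nat k"
      using b by (rule prime_field_cases)
    then have "e x b = e x 0 * e 1 1 ^ k"
      using assms(1) e_mult[of x 0 1 "of_nat k"] by (simp add: e_1_of_nat)
    then have "e x 0 - e x b = e x 0 * (1 - e 1 1 ^ k)"
      by (simp add: algebra_simps)
    then show ?thesis
      using l_dvd_one_minus_power by simp
  qed
  from dvd_diff[OF this[OF assms(3)] this[OF assms(2)]] show ?thesis
    by simp
qed

lemma push_scale_inert: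
  fixes u :: "'a graph_group \<Rightarrow>\<^sub>0 int"
  assumes "t \<in> prime_field"
  shows "l dvd push (scale t) u - u"
proof (induction u rule: poly_mapping_additive_induct)
  case (single k c)
  obtain x b where k: "x \<noteq> 0" "b \<in> prime_field" "k = pt x b"
    by (rule pt_cases)
  have "l dvd Poly_Mapping.single 0 c * (e x (t * b) - e x b)"
    using k assms by (intro dvd_mult l_dvd_e_diff) auto
  also have "Poly_Mapping.single 0 c * (e x (t * b) - e x b)
      = push (scale t) (Poly_Mapping.single k c) - Poly_Mapping.single k c"
    using k by (simp add: push_single scale_pt e_def right_diff_distrib mult_single)
  finally show ?case .
next
  case (add u v)
  then have "l dvd (push (scale t) u - u) + (push (scale t) v - v)"
    by (rule dvd_add)
  then show ?case by (simp add: push_add algebra_simps)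
qed

text \<open>The image of \<open>l\<close> is \<open>1 - e 1 t\<close>. If \<open>j\<close>
  represents the inverse of \<open>t\<close>, then \<open>e 1 t ^ j = e 1 1\<close>, and the
  geometric sum is the quotient.\<close>

lemma push_scale_l_dvd:
  assumes "t \<in> prime_field" "t \<noteq> (0::'a)"
  shows "push (scale t) l dvd l"
proof -
  obtain k where k: "t = of_nat k"
    using assms(1) by (rule prime_field_cases)
  obtain j where j: "inverse t = of_nat j"
    using inverse_in_prime_field[OF assms(1)] by (rule prime_field_cases)
  have push: "push (scale t) l = 1 - e 1 t"
  proof -
    have "push (scale t) l + push (scale t) (e 1 1) = push (scale t) (e 1 0)"
      unfolding push_add[symmetric] by (simp add: l_def e_one)
    then show ?thesis
      by (simp add: push_scale_e push_scale_one e_one algebra_simps)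
  qed
  have "e 1 t ^ j = (e 1 1 :: 'a graph_group \<Rightarrow>\<^sub>0 int)"
    using assms by (simp add: e_power flip: j)
  then have "l = (1 - e 1 t) * (\<Sum>i<j. e 1 t ^ i)"
    using one_diff_power_eq[of "e 1 t" j] by (simp add: l_def)
  then show ?thesis
    unfolding push by (metis dvd_triv_left)
qed

lemma l_square_dvd_prime: "l * l dvd l * of_nat p"
  by (metis l_mult_prime_eq dvd_triv_left)

lemma prime_dvd_power_add:
  fixes x y :: "'r::comm_ring_1"
  shows "of_nat p dvd (x + y) ^ (p ^ k) - x ^ (p ^ k) - y ^ (p ^ k)"
proof (induction k)
  case (Suc k)
  have base: "of_nat p dvd (a + b) ^ p - a ^ p - b ^ p" for a b :: 'r
  proof -
    have "(a + b) ^ p = (\<Sum>i\<le>p. of_nat (p choose i) * a ^ i * b ^ (p - i))"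
      by (rule binomial_ring)
    also have "{..p} = insert 0 (insert p {0<..<p})"
      using prime_gt_0_nat[OF prime] by auto
    also have "(\<Sum>i\<in>insert 0 (insert p {0<..<p}). of_nat (p choose i) * a ^ i * b ^ (p - i))
       = b ^ p + (a ^ p + (\<Sum>i\<in>{0<..<p}. of_nat (p choose i) * a ^ i * b ^ (p - i)))"
      using prime_gt_0_nat[OF prime] by simp
    finally have "(a + b) ^ p - a ^ p - b ^ p
        = (\<Sum>i\<in>{0<..<p}. of_nat (p choose i) * a ^ i * b ^ (p - i))"
      by simp
    moreover have "of_nat p dvd (of_nat (p choose i) :: 'r)" if "i \<in> {0<..<p}" for i
    proof -
      have "p dvd p choose i"
        using that prime by (intro dvd_choose_prime) auto
      then show ?thesis by (metis dvd_def of_nat_mult)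
    qed
    ultimately show ?thesis
      by (auto intro!: dvd_sum dvd_mult2)
  qed
  define a b c where "a = (x + y) ^ (p ^ k)" and "b = x ^ (p ^ k)" and "c = y ^ (p ^ k)"
  have "a - (b + c) dvd a ^ p - (b + c) ^ p"
    by (metis power_diff_sumr2 dvd_triv_left)
  moreover have "of_nat p dvd a - (b + c)"
    using Suc by (simp add: a_def b_def c_def algebra_simps)
  ultimately have "of_nat p dvd (a ^ p - (b + c) ^ p) + ((b + c) ^ p - b ^ p - c ^ p)"
    by (intro dvd_add base) (rule dvd_trans)
  then show ?case
    by (simp add: a_def b_def c_def algebra_simps flip: power_mult)
qed simp

lemma prime_dvd_int_power_diff: "int p dvd c ^ (p ^ i) - c"
proof (induction c rule: int_induct[where k = 0])
  case base
  then show ?case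
    using prime_gt_0_nat[OF prime] by (simp add: power_0_left)
next
  case (step1 c)
  have "int p dvd ((c + 1) ^ (p ^ i) - c ^ (p ^ i) - 1) + (c ^ (p ^ i) - c)"
    using prime_dvd_power_add[of c 1 i] step1 by (intro dvd_add) simp_all
  then show ?case by (simp add: algebra_simps)
next
  case (step2 c)
  have "int p dvd (c ^ (p ^ i) - c) - (c ^ (p ^ i) - (c - 1) ^ (p ^ i) - 1)"
    by (rule dvd_diff) (use prime_dvd_power_add[of "c - 1" 1 i] step2 in simp_all)
  then show ?case by (simp add: algebra_simps)
qed

text \<open>The power map is additive modulo \<open>p\<close>, fixes integers modulo
  \<open>p\<close> and field elements exactly, and changes second coordinates only. The factor
  \<open>l\<close> is there because \<open>l * p\<close>, unlike \<open>p\<close>, is a multiple of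
  \<open>l\<close>.\<close>

lemma frobenius:
  fixes u :: "'a graph_group \<Rightarrow>\<^sub>0 int"
  shows "l * l dvd l * (u ^ (p ^ n) - u)"
proof (induction u rule: poly_mapping_additive_induct)
  case (add u v)
  have "l * l dvd l * ((u + v) ^ (p ^ n) - u ^ (p ^ n) - v ^ (p ^ n))"
    using l_square_dvd_prime by (rule dvd_trans) (intro mult_dvd_mono prime_dvd_power_add dvd_refl)
  with add have "l * l dvd l * ((u + v) ^ (p ^ n) - u ^ (p ^ n) - v ^ (p ^ n))
      + (l * (u ^ (p ^ n) - u) + l * (v ^ (p ^ n) - v))"
    by (intro dvd_add)
  then show ?case by (simp add: algebra_simps)
next
  case (single k c)
  obtain x b where k: "x \<noteq> 0" "b \<in> prime_field" "k = pt x b"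
    by (rule pt_cases)
  have single: "Poly_Mapping.single k c = of_int c * e x b"
    by (simp add: k e_def mult_single flip: single_of_int)
  have pow: "e x b ^ (p ^ n) = e x 0"
    using k n by (simp add: e_power power_card of_nat_p power_0_left)
  have "Poly_Mapping.single k c ^ (p ^ n) - Poly_Mapping.single k c
     = of_int (c ^ (p ^ n)) * e x 0 - of_int c * e x b"
    unfolding single power_mult_distrib pow by simp
  also have "\<dots> = of_int (c ^ (p ^ n) - c) * e x 0 + of_int c * (e x 0 - e x b)"
    by (simp add: algebra_simps)
  finally have eq: "l * (Poly_Mapping.single k c ^ (p ^ n) - Poly_Mapping.single k c)
     = l * of_int (c ^ (p ^ n) - c) * e x 0 + l * (e x 0 - e x b) * of_int c"
    by (simp only: distrib_left mult_ac)
  obtain d where d: "c ^ (p ^ n) - c = int p * d"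
    using prime_dvd_int_power_diff by blast
  have "l * l dvd l * of_nat p * (of_int d * e x 0)"
    using l_square_dvd_prime by simp
  then have "l * l dvd l * of_int (c ^ (p ^ n) - c) * e x 0"
    unfolding d by (simp add: mult_ac)
  moreover have "l * l dvd l * (e x 0 - e x b) * of_int c"
    using k by (intro dvd_mult2 mult_dvd_mono l_dvd_e_diff) auto
  ultimately show ?case
    unfolding eq by (rule dvd_add)
qed

end

subsection \<open>Difference balanced functions\<close>

locale difference_balanced_function =
  prime_power_field p n "TYPE('a)" for p n and f :: "'a::{finite,field} \<Rightarrow> 'a" +
  assumes range: "x \<noteq> 0 \<Longrightarrow> f x \<in> prime_field"
    and difference_balanced: "difference_balanced p n f"
    and balanced: "balanced p n f"
begin

lemma balanced_scale:
  fixes h :: "'a \<Rightarrow> 'a"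
  assumes "balanced p n h" "t \<in> prime_field" "t \<noteq> 0"
  shows "balanced p n (\<lambda>x. t * h x)"
proof -
  have "{x. x \<noteq> 0 \<and> t * h x = b} = {x. x \<noteq> 0 \<and> h x = inverse t * b}" for b
    using assms(3) by (auto simp: field_simps)
  then show ?thesis
    using assms inverse_in_prime_field[OF assms(2)] by (simp add: balanced_def)
qed

text \<open>The sum is \<open>p ^ (n - 1) * \<Phi> - 1\<close>: all values are equally frequent,
  except that \<open>0\<close> is taken once less.\<close>

lemma l_mult_sum_balanced:
  fixes h :: "'a \<Rightarrow> 'a"
  assumes "balanced p n h" and h: "\<And>x. x \<noteq> 0 \<Longrightarrow> h x \<in> prime_field"
  shows "l * (\<Sum>x | x \<noteq> 0. e 1 (h x)) = - l"
proof -
  have "(\<Sum>x | x \<noteq> 0. e 1 (h x))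
      = (\<Sum>b\<in>prime_field. \<Sum>x\<in>{x \<in> {x. x \<noteq> 0}. h x = b}. e 1 (h x))"
    using h by (intro sum.group[symmetric]) auto
  also have "\<dots> = (\<Sum>b\<in>prime_field. of_nat (p ^ (n - 1)) * e 1 b - (if b = 0 then 1 else 0))"
  proof (rule sum.cong[OF refl])
    fix b :: 'a assume b: "b \<in> prime_field"
    have "(\<Sum>x\<in>{x \<in> {x. x \<noteq> 0}. h x = b}. e 1 (h x))
        = of_nat (card {x. x \<noteq> 0 \<and> h x = b}) * e 1 b"
      by simp
    also have "\<dots> = of_nat (p ^ (n - 1)) * e 1 b - (if b = 0 then 1 else 0)"
      using assms(1) b prime_gt_0_nat[OF prime]
      by (auto simp: balanced_def of_nat_diff e_one algebra_simps Suc_le_eq)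
    finally show "(\<Sum>x\<in>{x \<in> {x. x \<noteq> 0}. h x = b}. e 1 (h x))
        = of_nat (p ^ (n - 1)) * e 1 b - (if b = 0 then 1 else 0)" .
  qed
  also have "\<dots> = of_nat (p ^ (n - 1)) * \<Phi> - 1"
    by (simp add: sum_subtractf \<Phi>_eq sum_distrib_left)
  finally have "l * (\<Sum>x | x \<noteq> 0. e 1 (h x)) = of_nat (p ^ (n - 1)) * (l * \<Phi>) - l"
    by (simp only: right_diff_distrib mult.left_commute mult_1_right)
  then show ?thesis by (simp add: l_mult_\<Phi>)
qed

section \<open>The graph of \<open>f\<close> and its multipliers\<close>

definition graph :: "('a \<Rightarrow> 'a) \<Rightarrow> ('a graph_group \<Rightarrow>\<^sub>0 int)"
  where "graph h = (\<Sum>x | x \<noteq> 0. e x (h x))"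

text \<open>The image of \<open>graph f\<close> under inversion in the group, the \<theta>* of the
  overview.\<close>

definition adjoint :: "'a graph_group \<Rightarrow>\<^sub>0 int"
  where "adjoint = (\<Sum>x | x \<noteq> 0. e (inverse x) (- f x))"

abbreviation \<Gamma> :: "'a graph_group \<Rightarrow>\<^sub>0 int"
  where "\<Gamma> \<equiv> graph (\<lambda>_. 0)"

lemma e_mult_\<Gamma>:
  assumes "x \<noteq> 0" "b \<in> prime_field"
  shows "e x b * \<Gamma> = e 1 b * \<Gamma>"
proof -
  have "e x b * \<Gamma> = (\<Sum>y | y \<noteq> 0. e (x * y) b)"
    using assms by (simp add: graph_def sum_distrib_left e_mult)
  also have "\<dots> = (\<Sum>y | y \<noteq> 0. e y b)"
    by (rule sum.reindex_bij_witness[of _ "\<lambda>y. y / x" "\<lambda>y. x * y"]) (use assms in auto)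
  also have "\<dots> = e 1 b * \<Gamma>"
    using assms by (simp add: graph_def sum_distrib_left e_mult)
  finally show ?thesis .
qed

text \<open>\<open>\<Gamma>\<close> absorbs first coordinates, leaving the sum for a balanced
  function. The map \<open>i\<close> allows for both \<open>graph\<close> and
  \<open>adjoint\<close>.\<close>

lemma sum_e_mult_\<Gamma>:
  assumes "balanced p n h" "\<And>x. x \<noteq> 0 \<Longrightarrow> h x \<in> prime_field" "\<And>x. x \<noteq> 0 \<Longrightarrow> i x \<noteq> (0::'a)"
  shows "l * ((\<Sum>x | x \<noteq> 0. e (i x) (h x)) * \<Gamma>) = - (l * \<Gamma>)"
proof -
  have "(\<Sum>x | x \<noteq> 0. e (i x) (h x)) * \<Gamma> = (\<Sum>x | x \<noteq> 0. e 1 (h x)) * \<Gamma>"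
    unfolding sum_distrib_right by (intro sum.cong refl e_mult_\<Gamma>) (use assms in auto)
  then show ?thesis
    using l_mult_sum_balanced[OF assms(1,2)] by (simp flip: mult.assoc)
qed

lemma graph_mult_\<Gamma>:
  assumes "balanced p n h" "\<And>x. x \<noteq> 0 \<Longrightarrow> h x \<in> prime_field"
  shows "l * (graph h * \<Gamma>) = - (l * \<Gamma>)"
  unfolding graph_def[of h] by (rule sum_e_mult_\<Gamma>) (use assms in auto)

lemma adjoint_mult_\<Gamma>: "l * (adjoint * \<Gamma>) = - (l * \<Gamma>)"
  unfolding adjoint_def
  by (rule sum_e_mult_\<Gamma>) (use balanced_scale[OF balanced, of "- 1"] range in auto)

lemma \<Gamma>_mult_\<Gamma>: "\<Gamma> * \<Gamma> = of_nat (p ^ n - 1) * \<Gamma>"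
proof -
  have "\<Gamma> * \<Gamma> = (\<Sum>x::'a | x \<noteq> 0. \<Gamma>)"
    by (subst (1) graph_def) (simp add: sum_distrib_right e_mult_\<Gamma> e_one)
  then show ?thesis by (simp add: card_nonzero)
qed

lemma graph_mult_adjoint:
  assumes "\<And>x. x \<noteq> 0 \<Longrightarrow> g x \<in> prime_field"
  shows "graph g * adjoint = (\<Sum>a | a \<noteq> 0. \<Sum>y | y \<noteq> 0. e a (g (a * y) - f y))"
proof -
  have "graph g * adjoint = (\<Sum>y | y \<noteq> 0. \<Sum>x | x \<noteq> 0. e x (g x) * e (inverse y) (- f y))"
    unfolding graph_def adjoint_def sum_product by (rule sum.swap)
  also have "\<dots> = (\<Sum>y | y \<noteq> 0. \<Sum>x | x \<noteq> 0. e (x / y) (g x - f y))"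
    using assms range by (intro sum.cong refl) (simp add: e_mult field_simps)
  also have "\<dots> = (\<Sum>y | y \<noteq> 0. \<Sum>a | a \<noteq> 0. e a (g (a * y) - f y))"
  proof (rule sum.cong[OF refl])
    fix y :: 'a assume "y \<in> {y. y \<noteq> 0}"
    then show "(\<Sum>x | x \<noteq> 0. e (x / y) (g x - f y)) = (\<Sum>a | a \<noteq> 0. e a (g (a * y) - f y))"
      by (intro sum.reindex_bij_witness[of _ "\<lambda>a. a * y" "\<lambda>x. x / y"]) auto
  qed
  also have "\<dots> = (\<Sum>a | a \<noteq> 0. \<Sum>y | y \<noteq> 0. e a (g (a * y) - f y))"
    by (rule sum.swap)
  finally show ?thesis .
qed

text \<open>Grouped by the quotient \<open>a\<close>, the terms with \<open>a \<noteq> 1\<close>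
  give \<open>- e a 0\<close> by difference balancedness; \<open>a = 1\<close> gives
  \<open>p ^ n - 1\<close> copies of \<open>1\<close>.\<close>

lemma graph_mult_adjoint_self: "l * (graph f * adjoint) = l * (of_nat (p ^ n) - \<Gamma>)"
proof -
  have p: "p ^ n = Suc (p ^ n - 1)"
    using prime prime_gt_0_nat by simp
  have "l * (\<Sum>y | y \<noteq> 0. e a (f (a * y) - f y))
      = l * ((if a = 1 then of_nat (p ^ n) else 0) - e a 0)" if a: "a \<noteq> 0" for a
  proof (cases "a = 1")
    case True
    then show ?thesis
      by (subst p) (simp add: card_nonzero e_one)
  next
    case False
    have "balanced p n (\<lambda>x. f (a * x) - f x)"
      using difference_balanced False a by (simp add: difference_balanced_def)
    then have "l * (\<Sum>y | y \<noteq> 0. e 1 (f (a * y) - f y)) = - l"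
      by (rule l_mult_sum_balanced) (use range a in auto)
    moreover have "(\<Sum>y | y \<noteq> 0. e a (f (a * y) - f y))
        = e a 0 * (\<Sum>y | y \<noteq> 0. e 1 (f (a * y) - f y))"
      unfolding sum_distrib_left by (intro sum.cong refl) (use range a in \<open>simp add: e_mult\<close>)
    ultimately show ?thesis
      using False by (simp add: mult.left_commute[of l])
  qed
  then have "l * (graph f * adjoint)
      = (\<Sum>a | a \<noteq> 0. l * ((if a = 1 then of_nat (p ^ n) else 0) - e a 0))"
    by (subst graph_mult_adjoint) (auto simp: range sum_distrib_left intro!: sum.cong)
  also have "\<dots> = l * (\<Sum>a::'a | a \<noteq> 0. (if a = 1 then of_nat (p ^ n) else 0) - e a 0)"
    by (simp add: sum_distrib_left)
  also have "(\<Sum>a::'a | a \<noteq> 0. (if a = 1 then of_nat (p ^ n) else 0) - e a 0)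
      = of_nat (p ^ n) - \<Gamma>"
    by (simp add: sum_subtractf graph_def)
  finally show ?thesis .
qed

text \<open>
  Since \<open>- \<Gamma>\<close> is idempotent modulo \<open>p ^ n\<close>, subtracting \<open>\<Gamma>\<close> from both factors projects
  away the component of the trivial character, on which the product is not divisible by \<open>p\<close>.
\<close>

lemma reduced_mult_eq:
  assumes "l * (A * \<Gamma>) = - (l * \<Gamma>)"
  shows "l * ((A - \<Gamma>) * (adjoint - \<Gamma>)) = l * (A * adjoint + \<Gamma>) + l * of_nat p ^ n * \<Gamma>"
proof -
  have p: "of_nat p ^ n = (1 + of_nat (p ^ n - 1) :: 'a graph_group \<Rightarrow>\<^sub>0 int)"
    using prime_gt_0_nat[OF prime] by (simp flip: of_nat_power of_nat_Suc)
  have "l * ((A - \<Gamma>) * (adjoint - \<Gamma>))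
      = l * (A * adjoint) - l * (A * \<Gamma>) - l * (adjoint * \<Gamma>) + l * (\<Gamma> * \<Gamma>)"
    by (simp add: algebra_simps)
  then show ?thesis
    unfolding assms adjoint_mult_\<Gamma> \<Gamma>_mult_\<Gamma> p by (simp add: algebra_simps)
qed

text \<open>The product for \<open>f\<close> itself is known; \<open>\<sigma>\<close> acts on one
  factor only, and divisibility survives after translation into powers of \<open>l\<close>.\<close>

lemma multiplier_dvd:
  assumes "t \<in> prime_field" "t \<noteq> 0"
  shows "l * of_nat p ^ n dvd l * (graph (\<lambda>x. t * f x) * adjoint + \<Gamma>)"
proof -
  define \<sigma> where "\<sigma> = (push (scale t) :: ('a graph_group \<Rightarrow>\<^sub>0 int) \<Rightarrow> _)"
  have add: "\<sigma> (x + y) = \<sigma> x + \<sigma> y" for x y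
    by (simp add: \<sigma>_def push_add)
  have "l * ((graph f - \<Gamma>) * (adjoint - \<Gamma>))
      = l * (graph f * adjoint + \<Gamma>) + l * of_nat p ^ n * \<Gamma>"
    by (intro reduced_mult_eq graph_mult_\<Gamma> balanced range)
  also have "\<dots> = l * of_nat p ^ n * (1 + \<Gamma>)"
    using graph_mult_adjoint_self by (simp add: algebra_simps)
  finally have "l * ((graph f - \<Gamma>) * (adjoint - \<Gamma>)) = l * of_nat p ^ n * (1 + \<Gamma>)" .
  then have "l * of_nat p ^ n dvd l * ((graph f - \<Gamma>) * (adjoint - \<Gamma>))"
    by simp
  then have "l ^ Suc (n * (p - 1)) dvd l * ((graph f - \<Gamma>) * (adjoint - \<Gamma>))"
    using l_power_prime_power(1) by (rule dvd_trans[rotated])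
  then have "l ^ Suc (n * (p - 1)) dvd l * (\<sigma> (graph f - \<Gamma>) * (adjoint - \<Gamma>))"
  \<comment> \<open>With this \<open>N\<close>, the exponent \<open>Suc N\<close> is the Frobenius
    exponent \<open>p ^ n\<close>.\<close>
  proof (rule ramified_endomorphism_dvd[rotated -1, where N = "p ^ n - 1"])
    show "\<sigma> (x * y) = \<sigma> x * \<sigma> y" for x y
      unfolding \<sigma>_def by (rule push_mult) (rule scale_add[OF assms(1)])
    show "l dvd \<sigma> x - x" for x
      unfolding \<sigma>_def by (rule push_scale_inert[OF assms(1)])
    show "\<sigma> l dvd l"
      unfolding \<sigma>_def by (rule push_scale_l_dvd[OF assms])
    show "l * l dvd l * (x ^ Suc (p ^ n - 1) - x)" for x :: "'a graph_group \<Rightarrow>\<^sub>0 int"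
      using frobenius[of x] prime_gt_0_nat[OF prime] by simp
    show "p ^ n - 1 > 0"
      using prime_gt_1_nat[OF prime] n one_less_power[of p n] by simp
  qed (use l_cancel add in \<open>auto simp: \<sigma>_def push_scale_one\<close>)
  then have "l * of_nat p ^ n dvd l * (\<sigma> (graph f - \<Gamma>) * (adjoint - \<Gamma>))"
    using l_power_prime_power(2) by (rule dvd_trans[rotated])
  also have "\<sigma> (graph f - \<Gamma>) = graph (\<lambda>x. t * f x) - \<Gamma>"
  proof -
    have "\<sigma> (graph f - \<Gamma>) + \<sigma> \<Gamma> = \<sigma> (graph f)"
      unfolding add[symmetric] by simp
    moreover have "\<sigma> (graph f) = graph (\<lambda>x. t * f x)" "\<sigma> \<Gamma> = \<Gamma>"
      unfolding \<sigma>_def graph_def push_sum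
      by (intro sum.cong refl; simp add: push_scale_e range)+
    ultimately show ?thesis by (simp add: algebra_simps)
  qed
  finally have "l * of_nat p ^ n dvd
      l * (graph (\<lambda>x. t * f x) * adjoint + \<Gamma>) + l * of_nat p ^ n * \<Gamma>"
    using assms range
    by (subst (asm) reduced_mult_eq) (auto intro!: graph_mult_\<Gamma> balanced_scale balanced)
  then show ?thesis
    by (simp add: dvd_add_left_iff)
qed

section \<open>Counting solutions through coefficients\<close>

lemma coef_eq_of_l_mult_eq_0:
  assumes "l * y = 0" "a \<noteq> 0" "b \<in> prime_field"
  shows "coef y (pt a b) = coef y (pt a (0::'a))"
proof -
  \<comment> \<open>Being killed by \<open>l\<close> means invariance under translation by
    \<open>pt 1 1\<close>, whose multiples run through the prime field.\<close>
  have step: "coef y (pt a (c + 1)) = coef y (pt a c)" if "c \<in> prime_field" for c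
  proof -
    have "e 1 1 * y = y"
      using assms(1) by (simp add: l_def algebra_simps)
    moreover have "pt a (c + 1) = pt 1 1 + pt a c"
      using assms(2) that by (simp add: pt_add add.commute)
    moreover have "coef (e 1 1 * y) (pt 1 1 + pt a c) = coef y (pt a c)"
      unfolding e_def
    proof (rule lookup_translate)
      fix i j :: "'a graph_group"
      assume "pt 1 1 + i = pt 1 1 + j"
      then show "i = j"
        by (cases i rule: pt_cases; cases j rule: pt_cases) (simp add: pt_add pt_eq_iff)
    qed
    ultimately show ?thesis by simp
  qed
  have "coef y (pt a (of_nat k)) = coef y (pt a 0)" for k
  proof (induction k)
    case (Suc k)
    then show ?case
      using step[of "of_nat k"] by (simp add: add.commute)
  qed simp
  then show ?thesis
    using assms(3) by (auto elim: prime_field_cases)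
qed

lemma coef_graph_mult_adjoint:
  assumes g: "\<And>x. x \<noteq> 0 \<Longrightarrow> g x \<in> prime_field" and "a \<noteq> 0" "b \<in> prime_field"
  shows "coef (graph g * adjoint) (pt a b) = int (card {y. y \<noteq> 0 \<and> g (a * y) - f y = b})"
proof -
  have "graph g * adjoint = (\<Sum>a | a \<noteq> 0. \<Sum>y | y \<noteq> 0. e a (g (a * y) - f y))"
    by (rule graph_mult_adjoint) (rule g)
  then have "coef (graph g * adjoint) (pt a b)
      = (\<Sum>c | c \<noteq> 0. \<Sum>y | y \<noteq> 0. coef (e c (g (c * y) - f y)) (pt a b))"
    by (simp add: lookup_sum)
  also have "\<dots> = (\<Sum>c | c \<noteq> 0. \<Sum>y | y \<noteq> 0. of_bool (c = a \<and> g (c * y) - f y = b))"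
    by (intro sum.cong refl lookup_e) (use assms range in auto)
  also have "\<dots> = (\<Sum>c | c \<noteq> 0. if c = a then \<Sum>y | y \<noteq> 0. of_bool (g (a * y) - f y = b) else 0)"
    by (intro sum.cong refl) auto
  also have "\<dots> = (\<Sum>y | y \<noteq> 0. of_bool (g (a * y) - f y = b))"
    using assms by simp
  also have "\<dots> = int (card {y. y \<noteq> 0 \<and> g (a * y) - f y = b})"
    by (simp add: of_bool_def sum.If_cases Int_def)
  finally show ?thesis .
qed

lemma coef_\<Gamma>:
  assumes "a \<noteq> 0" "b \<in> prime_field"
  shows "coef \<Gamma> (pt a b) = of_bool (b = 0)"
proof -
  have "coef \<Gamma> (pt a b) = (\<Sum>x | x \<noteq> 0. if x = a then of_bool (b = 0) else 0)"
    unfolding graph_def lookup_sum by (intro sum.cong refl) (use assms in \<open>auto simp: lookup_e\<close>)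
  then show ?thesis using assms by simp
qed

lemma card_cong:
  assumes t: "t \<in> prime_field" "t \<noteq> 0" and a: "a \<noteq> 0" and b: "b \<in> prime_field"
  shows "[card {y. y \<noteq> 0 \<and> t * f (a * y) - f y = b} + of_bool (b = 0)
    = card {y. y \<noteq> 0 \<and> t * f (a * y) - f y = 0} + 1] (mod p ^ n)"
proof -
  define w where "w = graph (\<lambda>x. t * f x) * adjoint + \<Gamma>"
  obtain v where "l * w = l * of_nat p ^ n * v"
    using multiplier_dvd[OF t] by (auto simp: w_def)
  then have "l * (w - of_nat (p ^ n) * v) = 0"
    by (simp add: algebra_simps)
  from coef_eq_of_l_mult_eq_0[OF this a b]
  have "coef w (pt a b) - coef w (pt a 0) = int (p ^ n) * (coef v (pt a b) - coef v (pt a 0))"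
    by (simp only: lookup_minus lookup_of_nat_mult) (simp add: algebra_simps)
  then have "[coef w (pt a b) = coef w (pt a 0)] (mod int (p ^ n))"
    by (simp add: cong_iff_dvd_diff)
  moreover have "coef w (pt a c)
      = int (card {y. y \<noteq> 0 \<and> t * f (a * y) - f y = c} + of_bool (c = 0))"
    if "c \<in> prime_field" for c
    using that t a range by (simp add: w_def lookup_add coef_graph_mult_adjoint coef_\<Gamma>)
  ultimately show ?thesis
    using b by (simp only: Ints_0 cong_int_iff) simp
qed

text \<open>Unless all \<open>y\<close> are solutions, both sides of the congruence in
  \<open>card_cong\<close> are below \<open>p ^ n\<close> for \<open>b \<noteq> 0\<close>, hence
  equal. Summing over \<open>b\<close> then determines the count.\<close>

lemma card_zero_cases:
  assumes t: "t \<in> prime_field" "t \<noteq> 0" and a: "a \<noteq> 0"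
  shows "card {y. y \<noteq> 0 \<and> t * f (a * y) = f y} = p ^ (n - 1) - 1
    \<or> (\<forall>y. y \<noteq> 0 \<longrightarrow> t * f (a * y) = f y)"
proof -
  define K where "K b = card {y. y \<noteq> 0 \<and> t * f (a * y) - f y = b}" for b
  have pos: "p ^ n > 0"
    using prime_gt_0_nat[OF prime] by simp
  have le: "K b \<le> p ^ n - 1" for b
    unfolding K_def card_nonzero[symmetric] by (rule card_mono) auto
  show ?thesis
  proof (cases "K 0 = p ^ n - 1")
    case True
    then have "{y. y \<noteq> 0 \<and> t * f (a * y) - f y = 0} = {y::'a. y \<noteq> 0}"
      by (intro card_subset_eq) (auto simp: K_def card_nonzero)
    then show ?thesis by auto
  next
    case False
    have eq: "K b + of_bool (b = 0) = K 0 + 1" if "b \<in> prime_field" for b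
    proof (cases "b = 0")
      case False
      have "[K b = K 0 + 1] (mod p ^ n)"
        using card_cong[OF t a that] False by (simp add: K_def)
      moreover have "K b < p ^ n" "K 0 + 1 < p ^ n"
        using le[of b] le[of 0] \<open>K 0 \<noteq> p ^ n - 1\<close> pos by linarith+
      ultimately show ?thesis
        using False by (simp add: cong_less_modulus_unique_nat)
    qed simp
    have "(\<Sum>b\<in>prime_field. K b) = (\<Sum>b\<in>prime_field. \<Sum>y\<in>{y \<in> {y. y \<noteq> 0}. t * f (a * y) - f y = b}. 1)"
      by (simp add: K_def)
    also have "\<dots> = (\<Sum>y::'a | y \<noteq> 0. 1)"
      by (rule sum.group) (use range t a in auto)
    finally have "(\<Sum>b\<in>prime_field. K b) = p ^ n - 1"
      by (simp add: card_nonzero)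
    moreover have "(\<Sum>b\<in>prime_field. K b + of_bool (b = 0)) = (\<Sum>b\<in>(prime_field :: 'a set). K 0 + 1)"
      by (intro sum.cong refl eq)
    ultimately have "p ^ n - 1 + 1 = p * (K 0 + 1)"
      by (simp add: sum.distrib card_prime_field[OF prime card] of_bool_def)
    then have "p * p ^ (n - 1) = p * (K 0 + 1)"
      using pos n by (simp flip: power_Suc)
    then have "K 0 + 1 = p ^ (n - 1)"
      unfolding nat_mult_eq_cancel1[OF prime_gt_0_nat[OF prime]] by (rule sym)
    then have "K 0 = p ^ (n - 1) - 1" by simp
    then show ?thesis by (simp add: K_def)
  qed
qed

text \<open>Otherwise each \<open>a\<close> has \<open>q - 1\<close> solutions \<open>y\<close>.
  Counting the same pairs by \<open>y\<close> and \<open>x = a * y\<close> gives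
  \<open>(p ^ n - 1) * q - (q - 1)\<close>, which forces \<open>p ^ n = q\<close>.\<close>

lemma multiplier_exists:
  assumes t: "t \<in> prime_field" "t \<noteq> 0"
  obtains a where "a \<noteq> 0" "\<And>x. x \<noteq> 0 \<Longrightarrow> t * f (a * x) = f x"
proof (rule ccontr)
  assume "\<not> thesis"
  with that have no: "\<And>a. a \<noteq> 0 \<Longrightarrow> \<not> (\<forall>x. x \<noteq> 0 \<longrightarrow> t * f (a * x) = f x)"
    by blast
  define q where "q = p ^ (n - 1)"
  have q: "q \<ge> 1" "p ^ n = p * q"
    using prime_gt_0_nat[OF prime] n by (auto simp: q_def Suc_le_eq simp flip: power_Suc)
  define s where "s = inverse t"
  have s: "s \<in> prime_field" "s \<noteq> 0"
    using t inverse_in_prime_field by (auto simp: s_def)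
  have eq: "t * u = v \<longleftrightarrow> u = s * v" for u v
    using t by (auto simp: s_def field_simps)
  have card_f: "int (card {x. x \<noteq> 0 \<and> f x = b}) = int q - of_bool (b = 0)" if "b \<in> prime_field" for b
    using balanced that q by (auto simp: balanced_def q_def of_nat_diff)
  have "(\<Sum>a::'a | a \<noteq> 0. int q - 1)
      = (\<Sum>a | a \<noteq> 0. int (card {y. y \<noteq> 0 \<and> t * f (a * y) = f y}))"
    using card_zero_cases[OF t] no q(1)
    by (intro sum.cong refl) (auto simp: q_def of_nat_diff)
  also have "\<dots> = (\<Sum>a | a \<noteq> 0. \<Sum>y | y \<noteq> 0. of_bool (t * f (a * y) = f y))"
    by (simp add: of_bool_def sum.If_cases Int_def)
  also have "\<dots> = (\<Sum>y | y \<noteq> 0. \<Sum>a | a \<noteq> 0. of_bool (t * f (a * y) = f y))"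
    by (rule sum.swap)
  also have "\<dots> = (\<Sum>y | y \<noteq> 0. \<Sum>x | x \<noteq> 0. of_bool (f x = s * f y))"
  proof (rule sum.cong[OF refl])
    fix y :: 'a assume "y \<in> {y. y \<noteq> 0}"
    then show "(\<Sum>a | a \<noteq> 0. of_bool (t * f (a * y) = f y))
        = (\<Sum>x | x \<noteq> 0. of_bool (f x = s * f y) :: int)"
      by (intro sum.reindex_bij_witness[of _ "\<lambda>x. x / y" "\<lambda>a. a * y"]) (auto simp: eq)
  qed
  also have "\<dots> = (\<Sum>y | y \<noteq> 0. int (card {x. x \<noteq> 0 \<and> f x = s * f y}))"
    by (simp add: of_bool_def sum.If_cases Int_def)
  also have "\<dots> = (\<Sum>y | y \<noteq> 0. int q - of_bool (f y = 0))"
    using s range by (intro sum.cong refl) (simp add: card_f)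
  also have "\<dots> = (\<Sum>y::'a | y \<noteq> 0. int q) - int (card {y. y \<noteq> 0 \<and> f y = 0})"
    by (simp add: sum_subtractf) (simp add: of_bool_def sum.If_cases Int_def)
  finally have "int (p ^ n - 1) = int q - 1"
    by (simp add: card_nonzero card_f algebra_simps)
  then have "p * q = q"
    using q prime_gt_0_nat[OF prime] by (simp add: of_nat_diff)
  then show False
    using q(1) prime_gt_1_nat[OF prime] by simp
qed

end

section \<open>The degree of homogeneity\<close>

lemma coprime_of_power_eq_generator:
  fixes h s :: "'a::field"
  assumes "m > 0" "h ^ m = 1" "\<And>i. s ^ i = 1 \<Longrightarrow> m dvd i" "s = h ^ d"
  shows "coprime d m"
proof -
  define g where "g = gcd d m"
  obtain i where i: "m = g * i"
    unfolding g_def by (metis gcd_dvd2 dvd_def)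
  obtain j where j: "d = g * j"
    unfolding g_def by (metis gcd_dvd1 dvd_def)
  \<comment> \<open>A common factor \<open>g\<close> would give \<open>s\<close> an order dividing
    \<open>m div g\<close>.\<close>
  have "s ^ i = (h ^ m) ^ j"
    by (simp add: assms(4) i j mult_ac flip: power_mult)
  then have "m dvd i"
    using assms(2,3) by simp
  moreover have "i > 0"
    using i assms(1) by (cases i) auto
  ultimately have "g * i \<le> i"
    unfolding i by (rule dvd_imp_le)
  moreover have "g > 0"
    using i assms(1) by (cases g) auto
  ultimately have "g = 1"
    using \<open>i > 0\<close> by simp
  then show ?thesis
    unfolding g_def by (rule gcd_eq_1_imp_coprime)
qed

theorem theorem5p4:
  fixes p n :: nat
    and f :: "'a::{finite,field} \<Rightarrow> 'a"
  assumes "prime p" and "odd p" and "n \<ge> 1"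
    and "CARD('a) = p ^ n"
    and "\<And>x. x \<noteq> 0 \<Longrightarrow> f x \<in> prime_field"
    and "difference_balanced p n f"
    and "balanced p n f"
  shows "\<exists>d::int. homogeneous p d f"
proof -
  interpret difference_balanced_function p n f
    by standard (use assms in auto)
  have p1: "p - 1 > 0"
    using prime_gt_1_nat[OF prime] by simp
  obtain r where r: "residue_primroot p r"
    using prime_primitive_root_exists[of p] prime prime_gt_1_nat by auto
  define t where "t = (of_nat r :: 'a)"
  have t: "t \<in> prime_field" by (simp add: t_def)
  have t_power: "t ^ i = 1 \<longleftrightarrow> p - 1 dvd i" for i
  proof -
    have "t ^ i = 1 \<longleftrightarrow> [r ^ i = 1] (mod p)"
      using of_nat_eq_iff[of "r ^ i" 1] by (simp add: t_def)
    also have "\<dots> \<longleftrightarrow> ord p r dvd i"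
      by (rule ord_divides)
    also have "ord p r = p - 1"
      using r prime by (simp add: residue_primroot_def totient_prime)
    finally show ?thesis .
  qed
  have t_p1: "t ^ (p - 1) = 1"
    by (simp add: t_power)
  then have t0: "t \<noteq> 0"
    using p1 by (auto simp: power_0_left)
  define s where "s = inverse t"
  have s: "s \<in> prime_field" "s \<noteq> 0"
    using t t0 inverse_in_prime_field by (auto simp: s_def)
  have s_power: "s ^ i = 1 \<longleftrightarrow> t ^ i = 1" for i
    by (simp add: s_def power_inverse)
  obtain h where h: "h \<noteq> 0" "\<And>x. x \<noteq> 0 \<Longrightarrow> t * f (h * x) = f x"
    using multiplier_exists[OF t t0] by blast
  have "f (h * x) = s * f x" if "x \<noteq> 0" for x
    using h(2)[OF that] t0 by (simp add: s_def field_simps)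
  then have f_power: "f (h ^ i * x) = s ^ i * f x" if "x \<noteq> 0" for i x
    using that h(1) by (induction i) (simp_all add: mult.assoc)
  \<comment> \<open>Otherwise the difference of \<open>f\<close> along \<open>h ^ (p - 1)\<close>,
    which vanishes identically, would be balanced.\<close>
  have h_p1: "h ^ (p - 1) = 1"
  proof (rule ccontr)
    assume "h ^ (p - 1) \<noteq> 1"
    then have "card {x. x \<noteq> 0 \<and> f (h ^ (p - 1) * x) - f x = 0} = p ^ (n - 1) - 1"
      using difference_balanced h(1) by (simp add: difference_balanced_def balanced_def)
    moreover have "{x. x \<noteq> 0 \<and> f (h ^ (p - 1) * x) - f x = 0} = {x. x \<noteq> 0}"
      using f_power t_p1 s_power by auto
    ultimately have "p ^ (n - 1) - 1 = p ^ n - 1"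
      by (simp add: card_nonzero)
    moreover have "p ^ (n - 1) < p ^ n" "p ^ (n - 1) > 0"
      using prime_gt_1_nat[OF prime] n by (auto intro: power_strict_increasing)
    ultimately show False by linarith
  qed
  \<comment> \<open>At a point with value \<open>1\<close>, \<open>f (h ^ i * x1) = s ^ i\<close>,
    so the order of \<open>h\<close> is a multiple of that of \<open>s\<close>.\<close>
  have "card {x. x \<noteq> 0 \<and> f x = 1} > 0"
    using balanced prime_gt_0_nat[OF prime] by (simp add: balanced_def)
  then obtain x1 where x1: "x1 \<noteq> 0" "f x1 = 1"
    by (auto simp: card_gt_0_iff)
  have h_power: "p - 1 dvd i" if "h ^ i = 1" for i
    using f_power[OF x1(1), of i] that x1(2) s_power t_power by simp
  \<comment> \<open>The roots of \<open>X ^ (p - 1) - 1\<close>: by degree and Fermat they are the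
    nonzero prime field elements, which puts \<open>h\<close> into the prime field.\<close>
  define R where "R = {x::'a. x ^ (p - 1) = 1}"
  have "card R \<le> p - 1"
  proof -
    define P :: "'a poly" where "P = monom 1 (p - 1) + [:- 1:]"
    have deg: "degree P = p - 1"
      unfolding P_def using p1 by (subst degree_add_eq_left) (auto simp: degree_monom_eq)
    then have "P \<noteq> 0" using p1 by auto
    moreover have "R = {x. poly P x = 0}"
      by (simp add: R_def P_def poly_monom)
    ultimately show ?thesis
      using card_poly_roots_bound[of P] deg by simp
  qed
  moreover have sub: "prime_field - {0} \<subseteq> R"
  proof
    fix b :: 'a assume b: "b \<in> prime_field - {0}"
    then obtain k where k: "b = of_nat k"
      by (auto elim: prime_field_cases)
    have "\<not> p dvd k"
      using b of_nat_eq_iff[of k 0] by (auto simp: k cong_0_iff)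
    then have "[k ^ (p - 1) = 1] (mod p)"
      using prime by (intro fermat_theorem) auto
    then show "b \<in> R"
      using of_nat_eq_iff[of "k ^ (p - 1)" 1] by (simp add: R_def k)
  qed
  moreover have "card (prime_field - {0} :: 'a set) = p - 1"
    by (simp add: card_prime_field[OF prime card])
  ultimately have R: "R = prime_field - {0}"
    by (metis card_seteq finite)
  have "inj_on (\<lambda>i. h ^ i) {..<p - 1}"
  proof (rule linorder_inj_onI)
    fix i j assume ij: "i < j" "i \<in> {..<p - 1}" "j \<in> {..<p - 1}"
    show "h ^ i \<noteq> h ^ j"
    proof
      assume "h ^ i = h ^ j"
      also have "h ^ j = h ^ i * h ^ (j - i)"
        using ij(1) by (simp flip: power_add)
      finally have "p - 1 dvd j - i"
        using h(1) by (intro h_power) simp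
      then show False
        using ij by (auto dest: dvd_imp_le)
    qed
  qed auto
  then have "card ((\<lambda>i. h ^ i) ` {..<p - 1}) = p - 1"
    by (simp add: card_image)
  moreover have "(\<lambda>i. h ^ i) ` {..<p - 1} \<subseteq> R"
    using h_p1 by (auto simp: R_def) (metis mult.commute power_mult power_one)
  ultimately have gen: "(\<lambda>i. h ^ i) ` {..<p - 1} = R"
    using \<open>card R \<le> p - 1\<close> by (intro card_seteq) simp_all
  have "s \<in> R"
    unfolding R using s by auto
  then obtain d where d: "s = h ^ d"
    using gen by auto
  have "coprime d (p - 1)"
    using p1 h_p1 t_power s_power d by (intro coprime_of_power_eq_generator[of "p - 1" h s]) auto
  then have "gcd d (p - 1) = 1"
    by (rule coprime_imp_gcd_eq_1)
  moreover have "int p - 1 = int (p - 1)"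
    using p1 by simp
  ultimately have gcd: "gcd (int d) (int p - 1) = 1"
    by (simp only: gcd_int_int_eq of_nat_1)
  have hom: "f (a * x) = a powi int d * f x" if a: "a \<in> prime_field - {0}" and "x \<noteq> 0" for a x
  proof -
    obtain k where k: "a = h ^ k"
      using gen a unfolding R by blast
    \<comment> \<open>Both are \<open>h ^ (k * d)\<close>.\<close>
    have "a powi int d = s ^ k"
      unfolding k d power_int_of_nat power_mult[symmetric] by (simp only: mult.commute)
    then show ?thesis
      using f_power[OF \<open>x \<noteq> 0\<close>, of k] by (simp only: k)
  qed
  show ?thesis
    unfolding homogeneous_def by (intro exI[of _ "int d"] conjI ballI allI impI gcd hom)
qed

end
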